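(* Let $\mathcal M=(M,R)$ be a set $M$ with an equivalence relation $R$ having at least two classes, all classes being of equal cardinality, and this cardinality being at least two. Then $\mathcal M$ has no transitive extensions.
   Context: Let $\mathcal M$ be a first-order structure with universe $M$. A one-point extension of $\mathcal M$ is a first-order structure $\mathcal M'$ (in any language) with universe $M\cup\{0\}$, where $0\notin M$ is a new element, such that the stabilizer $\mathrm{Aut}(\mathcal M')_0$ of $0$, acting on $M$, equals $\mathrm{Aut}(\mathcal M)$ as a permutation group on $M$. A transitive extension of $\mathcal M$ is a one-point extension whose automorphism group acts transitively on $M\cup\{0\}$. *)

theory Defs
  imports "HOL-Combinatorics.Permutations" "HOL-Library.Equipollence"
begin

text \<open>
  Symbols are given by sets, not whole types, so that a language may lack function symbols or
  relation symbols altogether. Constants are function symbols of arity 0.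
\<close>

record ('f, 'r) fo_language =
  fun_symbols :: "'f set"
  rel_symbols :: "'r set"
  fun_arity :: "'f \<Rightarrow> nat"
  rel_arity :: "'r \<Rightarrow> nat"

record ('a, 'f, 'r) fo_structure =
  language :: "('f, 'r) fo_language"
  universe :: "'a set"
  fun_interp :: "'f \<Rightarrow> 'a list \<Rightarrow> 'a"
  rel_interp :: "'r \<Rightarrow> 'a list set"

definition tuples :: "'a set \<Rightarrow> nat \<Rightarrow> 'a list set" where
  "tuples A n = {xs. set xs \<subseteq> A \<and> length xs = n}"

definition is_fo_structure :: "('a, 'f, 'r) fo_structure \<Rightarrow> bool" where
  "is_fo_structure S \<longleftrightarrow>
     universe S \<noteq> {} \<and>
     (\<forall>f \<in> fun_symbols (language S). \<forall>xs \<in> tuples (universe S) (fun_arity (language S) f).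
        fun_interp S f xs \<in> universe S) \<and>
     (\<forall>r \<in> rel_symbols (language S).
        rel_interp S r \<subseteq> tuples (universe S) (rel_arity (language S) r))"

text \<open>
  Permutations of the universe are represented, as usual for \<open>permutes\<close>, by functions on the
  whole type that are the identity off the universe; thus equality of permutation groups on the
  universe is equality of sets of functions.
\<close>

definition Aut :: "('a, 'f, 'r) fo_structure \<Rightarrow> ('a \<Rightarrow> 'a) set" where
  "Aut S = {p. p permutes universe S \<and>
     (\<forall>f \<in> fun_symbols (language S). \<forall>xs \<in> tuples (universe S) (fun_arity (language S) f).
        p (fun_interp S f xs) = fun_interp S f (map p xs)) \<and>
     (\<forall>r \<in> rel_symbols (language S). \<forall>xs \<in> tuples (universe S) (rel_arity (language S) r).
        map p xs \<in> rel_interp S r \<longleftrightarrow> xs \<in> rel_interp S r)}"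

definition point_stabilizer :: "('a \<Rightarrow> 'a) set \<Rightarrow> 'a \<Rightarrow> ('a \<Rightarrow> 'a) set" where
  "point_stabilizer G x = {p \<in> G. p x = x}"

definition transitive_on :: "('a \<Rightarrow> 'a) set \<Rightarrow> 'a set \<Rightarrow> bool" where
  "transitive_on G A \<longleftrightarrow> (\<forall>x \<in> A. \<forall>y \<in> A. \<exists>p \<in> G. p x = y)"

text \<open>
  The new point 0 is \<open>None\<close>, and \<open>x\<close> in the old universe is identified with \<open>Some x\<close>; the option
  type guarantees that a new point is available whatever the old universe is. A permutation of
  the new universe fixing \<open>None\<close> is \<open>map_option p\<close> for a unique permutation \<open>p\<close> of the old one,
  namely its action there. The languages of the two structures are unrelated.
\<close>

definition one_point_extension ::
  "('a, 'f, 'r) fo_structure \<Rightarrow> ('a option, 'g, 's) fo_structure \<Rightarrow> bool" where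
  "one_point_extension S T \<longleftrightarrow>
     is_fo_structure T \<and>
     universe T = insert None (Some ` universe S) \<and>
     point_stabilizer (Aut T) None = map_option ` Aut S"

definition transitive_extension ::
  "('a, 'f, 'r) fo_structure \<Rightarrow> ('a option, 'g, 's) fo_structure \<Rightarrow> bool" where
  "transitive_extension S T \<longleftrightarrow>
     one_point_extension S T \<and> transitive_on (Aut T) (universe T)"

text \<open>
  The structure \<open>(M, R)\<close>: one binary relation symbol and no function symbols (so the value of
  \<open>fun_interp\<close> is irrelevant).
\<close>

definition binary_structure :: "'a set \<Rightarrow> ('a \<times> 'a) set \<Rightarrow> ('a, unit, unit) fo_structure" where
  "binary_structure M R =
     \<lparr>language = \<lparr>fun_symbols = {}, rel_symbols = {()}, fun_arity = (\<lambda>_. 0), rel_arity = (\<lambda>_. 2)\<rparr>,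
      universe = M,
      fun_interp = (\<lambda>_ _. undefined),
      rel_interp = (\<lambda>_. {[x, y] | x y. (x, y) \<in> R})\<rparr>"

end

theory Submission
  imports Defs
begin

text \<open>
  Let \<open>G\<close> be the automorphism group of a transitive extension. Transporting \<open>R\<close> by \<open>G\<close> gives every
  point \<open>x\<close> an equivalence relation \<open>D x\<close> on the remaining points, with \<open>D None = R\<close>. The stabilizer
  of \<open>None\<close> and \<open>a\<close> has only two orbits on the other points, and \<open>G\<close> is 2-transitive; hence either
  \<open>D x y z = D y x z\<close> for all distinct \<open>x\<close>, \<open>y\<close>, \<open>z\<close>, or \<open>D x y z = (\<not> D y x z)\<close> for all of them.
  As \<open>D x y z = D x z y\<close>, the second alternative negates a truth value an odd number of times
  around a triangle, which is absurd. In the first, \<open>D\<close> is the collinearity relation of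
  a linear space whose lines have at least three points. Take a line meeting three distinct lines
  through \<open>None\<close> in \<open>a\<close>, \<open>b\<close>, \<open>c\<close>. The stabilizer of \<open>None\<close> contains a transposition moving \<open>b\<close>
  along its line through \<open>None\<close>; it fixes \<open>a\<close> and \<open>c\<close>, hence their line, hence \<open>b\<close>, a contradiction.
\<close>

section \<open>Automorphisms are closed under composition and inverse\<close>

lemma permutes_map_args:
  assumes "p permutes A" "xs \<in> tuples A n"
  shows "map p xs \<in> tuples A n"
  using assms by (auto simp: tuples_def permutes_in_image)

lemma Aut_comp:
  assumes "p \<in> Aut S" "q \<in> Aut S"
  shows "p \<circ> q \<in> Aut S"
proof -
  have pq: "p permutes universe S" "q permutes universe S"
    using assms by (auto simp: Aut_def)
  have "(p \<circ> q) (fun_interp S f xs) = fun_interp S f (map (p \<circ> q) xs)"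
    if "f \<in> fun_symbols (language S)" "xs \<in> tuples (universe S) (fun_arity (language S) f)" for f xs
  proof -
    have "map q xs \<in> tuples (universe S) (fun_arity (language S) f)"
      using permutes_map_args pq that by blast
    then show ?thesis using assms that by (simp add: Aut_def)
  qed
  moreover have "map (p \<circ> q) xs \<in> rel_interp S r \<longleftrightarrow> xs \<in> rel_interp S r"
    if "r \<in> rel_symbols (language S)" "xs \<in> tuples (universe S) (rel_arity (language S) r)" for r xs
  proof -
    have "map q xs \<in> tuples (universe S) (rel_arity (language S) r)"
      using permutes_map_args pq that by blast
    then have "map p (map q xs) \<in> rel_interp S r \<longleftrightarrow> xs \<in> rel_interp S r"
      using assms that unfolding Aut_def by blast
    then show ?thesis by simp
  qed
  ultimately show ?thesis
    using pq permutes_compose unfolding Aut_def by blast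
qed

lemma Aut_inv:
  assumes S: "is_fo_structure S" and p: "p \<in> Aut S"
  shows "inv p \<in> Aut S"
proof -
  have perm: "p permutes universe S"
    using p by (auto simp: Aut_def)
  have iperm: "inv p permutes universe S"
    by (rule permutes_inv[OF perm])
  have map_inv: "map p (map (inv p) xs) = xs" for xs
    by (simp add: permutes_inv_o[OF perm])
  have "inv p (fun_interp S f xs) = fun_interp S f (map (inv p) xs)"
    if "f \<in> fun_symbols (language S)" "xs \<in> tuples (universe S) (fun_arity (language S) f)" for f xs
  proof -
    have "map (inv p) xs \<in> tuples (universe S) (fun_arity (language S) f)"
      using permutes_map_args iperm that by blast
    then have "p (fun_interp S f (map (inv p) xs)) = fun_interp S f (map p (map (inv p) xs))"
      using p that unfolding Aut_def by blast
    then show ?thesis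
      by (metis map_inv permutes_inverses(2)[OF perm])
  qed
  moreover have "map (inv p) xs \<in> rel_interp S r \<longleftrightarrow> xs \<in> rel_interp S r"
    if "r \<in> rel_symbols (language S)" "xs \<in> tuples (universe S) (rel_arity (language S) r)" for r xs
  proof -
    have "map (inv p) xs \<in> tuples (universe S) (rel_arity (language S) r)"
      using permutes_map_args iperm that by blast
    then have "map p (map (inv p) xs) \<in> rel_interp S r \<longleftrightarrow> map (inv p) xs \<in> rel_interp S r"
      using p that unfolding Aut_def by blast
    then show ?thesis by (simp only: map_inv)
  qed
  ultimately show ?thesis
    using iperm unfolding Aut_def by blast
qed

section \<open>Automorphisms of an equivalence relation\<close>

lemma Aut_binary_structure:
  "Aut (binary_structure M R) =
     {p. p permutes M \<and> (\<forall>x\<in>M. \<forall>y\<in>M. (p x, p y) \<in> R \<longleftrightarrow> (x, y) \<in> R)}"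
proof -
  have "(\<forall>xs\<in>tuples M 2. map p xs \<in> {[x, y] |x y. (x, y) \<in> R} \<longleftrightarrow> xs \<in> {[x, y] |x y. (x, y) \<in> R})
      \<longleftrightarrow> (\<forall>x\<in>M. \<forall>y\<in>M. (p x, p y) \<in> R \<longleftrightarrow> (x, y) \<in> R)" (is "?l \<longleftrightarrow> ?r") for p
  proof
    assume l: ?l
    show ?r
    proof (intro ballI)
      fix x y assume "x \<in> M" "y \<in> M"
      then have "[x, y] \<in> tuples M 2" by (simp add: tuples_def)
      from l[rule_format, OF this] show "(p x, p y) \<in> R \<longleftrightarrow> (x, y) \<in> R" by simp
    qed
  next
    assume r: ?r
    show ?l
    proof
      fix xs assume "xs \<in> tuples M 2"
      then obtain x y where "xs = [x, y]" "x \<in> M" "y \<in> M"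
        by (auto simp: tuples_def numeral_2_eq_2 length_Suc_conv)
      with r show "map p xs \<in> {[x, y] |x y. (x, y) \<in> R} \<longleftrightarrow> xs \<in> {[x, y] |x y. (x, y) \<in> R}" by simp
    qed
  qed
  then show ?thesis by (simp add: Aut_def binary_structure_def)
qed

text \<open>A self-inverse map is bijective, and applying \<open>pres\<close> to \<open>p x\<close>
  and \<open>p y\<close> yields the converse implication.\<close>

lemma involution_in_Aut_binary_structure:
  assumes invol: "\<And>x. p (p x) = x" and outside: "\<And>x. x \<notin> M \<Longrightarrow> p x = x"
    and pres: "\<And>x y. (x, y) \<in> R \<Longrightarrow> (p x, p y) \<in> R"
  shows "p \<in> Aut (binary_structure M R)"
proof -
  have "p permutes M"
    unfolding permutes_def
  proof (intro conjI allI impI ex1I)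
    show "p (p y) = y" for y by (rule invol)
    show "x = p y" if "p x = y" for x y using invol[of x] that by simp
  qed (rule outside)
  moreover have "(p x, p y) \<in> R \<longleftrightarrow> (x, y) \<in> R" for x y
    using pres[of x y] pres[of "p x" "p y"] by (auto simp: invol)
  ultimately show ?thesis by (simp add: Aut_binary_structure)
qed

text \<open>Such a transposition sends each point of \<open>M\<close> to an equivalent one, so it
  preserves every class.\<close>

lemma transpose_in_Aut_binary_structure:
  assumes eqv: "equiv M R" and ab: "(a, b) \<in> R"
  shows "transpose a b \<in> Aut (binary_structure M R)"
proof (rule involution_in_Aut_binary_structure)
  have sym: "(y, x) \<in> R" if "(x, y) \<in> R" for x y using that eqv by (meson equivE symD)
  have trans: "(x, z) \<in> R" if "(x, y) \<in> R" "(y, z) \<in> R" for x y z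
    using that eqv by (meson equivE transD)
  have in_M: "x \<in> M \<and> y \<in> M" if "(x, y) \<in> R" for x y
    using that equiv_type[OF eqv] by blast
  show "transpose a b x = x" if "x \<notin> M" for x
    using in_M[OF ab] that by (metis transpose_apply_other)
  have *: "(x, transpose a b x) \<in> R" if "(x, x) \<in> R" for x
    using that ab sym[OF ab] by (simp add: transpose_def)
  show "(transpose a b x, transpose a b y) \<in> R" if "(x, y) \<in> R" for x y
  proof -
    have "(x, x) \<in> R" "(y, y) \<in> R" using that sym trans by blast+
    then have "(transpose a b x, x) \<in> R" "(y, transpose a b y) \<in> R" using * sym by blast+
    then show ?thesis using that trans by blast
  qed
qed simp

text \<open>The map exchanges the two classes by a bijection and its inverse, and is the identity
  elsewhere; this makes it an involution preserving \<open>R\<close>.\<close>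

lemma swap_classes:
  assumes eqv: "equiv M R" and ab: "a \<in> M" "b \<in> M" "(a, b) \<notin> R"
    and equi: "R `` {a} \<approx> R `` {b}"
  obtains p where "p \<in> Aut (binary_structure M R)" "p a = b"
    "\<And>x. (a, x) \<notin> R \<Longrightarrow> (b, x) \<notin> R \<Longrightarrow> p x = x"
proof -
  let ?A = "R `` {a}" and ?B = "R `` {b}"
  have sym: "(y, x) \<in> R" if "(x, y) \<in> R" for x y using that eqv by (meson equivE symD)
  have trans: "(x, z) \<in> R" if "(x, y) \<in> R" "(y, z) \<in> R" for x y z
    using that eqv by (meson equivE transD)
  have aA: "a \<in> ?A" and bB: "b \<in> ?B" using ab eqv by (auto simp: equiv_def refl_on_def)
  have disj: "x \<notin> ?B" if "x \<in> ?A" for x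
    using that ab(3) sym trans by blast
  have subM: "x \<in> M" if "x \<in> ?A \<or> x \<in> ?B" for x
    using that equiv_type[OF eqv] by blast
  obtain h0 where h0: "bij_betw h0 ?A ?B" using equi unfolding eqpoll_def by blast
  \<comment> \<open>The bijection \<open>h0\<close> need not send \<open>a\<close> to
    \<open>b\<close>. A transposition inside the class of \<open>b\<close> corrects this.\<close>
  define h where "h = transpose (h0 a) b \<circ> h0"
  have "h0 a \<in> ?B" using h0 aA by (rule bij_betwE[THEN bspec])
  then have "bij_betw (transpose (h0 a) b) ?B ?B"
    using bB by (simp add: permutes_swap_id permutes_imp_bij)
  then have h: "bij_betw h ?A ?B" unfolding h_def by (rule bij_betw_trans[OF h0])
  have ha: "h a = b" by (simp add: h_def)
  define k where "k = inv_into ?A h"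
  have hB: "h x \<in> ?B" "k (h x) = x" if "x \<in> ?A" for x
    using h that unfolding k_def by (auto simp: bij_betw_inv_into_left dest: bij_betwE)
  have kA: "k x \<in> ?A" "h (k x) = x" if "x \<in> ?B" for x
    using h that bij_betw_inv_into[OF h] unfolding k_def
    by (blast dest: bij_betwE, simp add: bij_betw_inv_into_right)
  define p where "p x = (if x \<in> ?A then h x else if x \<in> ?B then k x else x)" for x
  have pA: "p x = h x" if "x \<in> ?A" for x using that by (simp add: p_def)
  have pB: "p x = k x" if "x \<in> ?B" for x using that disj by (auto simp: p_def)
  have pO: "p x = x" if "x \<notin> ?A" "x \<notin> ?B" for x using that by (simp add: p_def)
  have invol: "p (p x) = x" for x
    by (metis pA pB pO hB kA)
  have pres: "(p x, p y) \<in> R" if xy: "(x, y) \<in> R" for x y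
  proof -
    consider "x \<in> ?A" "y \<in> ?A" | "x \<in> ?B" "y \<in> ?B"
      | "x \<notin> ?A" "x \<notin> ?B" "y \<notin> ?A" "y \<notin> ?B"
      using xy sym trans by blast
    then show ?thesis
    proof cases
      case 1
      then have "p x \<in> ?B" "p y \<in> ?B" using hB pA by auto
      then show ?thesis using sym trans by blast
    next
      case 2
      then have "p x \<in> ?A" "p y \<in> ?A" using kA pB by auto
      then show ?thesis using sym trans by blast
    next
      case 3
      then show ?thesis using xy pO by simp
    qed
  qed
  have "p x = x" if "x \<notin> M" for x using pO subM that by blast
  then have "p \<in> Aut (binary_structure M R)"
    using invol pres by (intro involution_in_Aut_binary_structure) auto
  moreover have "p a = b" using pA aA ha by simp
  moreover have "p x = x" if "(a, x) \<notin> R" "(b, x) \<notin> R" for x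
    using pO that by blast
  ultimately show thesis using that by blast
qed

section \<open>A hypothetical transitive extension and its automorphism group\<close>

locale equiv_transitive_extension =
  fixes M :: "'a set" and R :: "('a \<times> 'a) set" and T :: "('a option, 'f, 'r) fo_structure"
  assumes equivalence: "equiv M R"
    and two_classes: "\<exists>C \<in> M // R. \<exists>D \<in> M // R. C \<noteq> D"
    and equal_classes: "\<forall>C \<in> M // R. \<forall>D \<in> M // R. C \<approx> D"
    and nontrivial_classes: "\<forall>C \<in> M // R. \<exists>x \<in> C. \<exists>y \<in> C. x \<noteq> y"
    and extension: "transitive_extension (binary_structure M R) T"
begin

abbreviation "\<Omega> \<equiv> insert None (Some ` M)"

lemma R_sym: "(x, y) \<in> R \<Longrightarrow> (y, x) \<in> R"
  using equivalence by (meson equivE symD)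

lemma R_trans: "(x, y) \<in> R \<Longrightarrow> (y, z) \<in> R \<Longrightarrow> (x, z) \<in> R"
  using equivalence by (meson equivE transD)

lemma R_refl: "x \<in> M \<Longrightarrow> (x, x) \<in> R"
  using equivalence by (meson equivE refl_onD)

lemma R_in: "(x, y) \<in> R \<Longrightarrow> x \<in> M" "(x, y) \<in> R \<Longrightarrow> y \<in> M"
  using equiv_type[OF equivalence] by blast+

lemma other_in_class:
  assumes "x \<in> M"
  obtains y where "(x, y) \<in> R" "y \<noteq> x"
proof -
  have "R `` {x} \<in> M // R" using assms by (rule quotientI)
  with nontrivial_classes obtain y z where "y \<in> R `` {x}" "z \<in> R `` {x}" "y \<noteq> z"
    by metis
  then show thesis using that by (metis Image_singleton_iff)
qed

lemma other_class:
  assumes "x \<in> M"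
  obtains y where "y \<in> M" "(x, y) \<notin> R"
proof -
  obtain u v where "u \<in> M" "v \<in> M" "R `` {u} \<noteq> R `` {v}"
    using two_classes by (auto elim!: quotientE)
  then have "(u, v) \<notin> R" using equiv_class_eq[OF equivalence] by blast
  then have "(x, u) \<notin> R \<or> (x, v) \<notin> R" using R_sym R_trans by blast
  then show thesis using that \<open>u \<in> M\<close> \<open>v \<in> M\<close> by blast
qed

lemma universe_T: "universe T = \<Omega>"
  and structure_T: "is_fo_structure T"
  and stabilizer_T: "point_stabilizer (Aut T) None = map_option ` Aut (binary_structure M R)"
  and transitive_T: "transitive_on (Aut T) \<Omega>"
proof -
  have "universe (binary_structure M R) = M" by (simp add: binary_structure_def)
  with extension show universe: "universe T = \<Omega>" and "is_fo_structure T"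
    and "point_stabilizer (Aut T) None = map_option ` Aut (binary_structure M R)"
    by (simp_all add: transitive_extension_def one_point_extension_def)
  from extension have "transitive_on (Aut T) (universe T)"
    by (simp add: transitive_extension_def)
  then show "transitive_on (Aut T) \<Omega>" by (simp only: universe)
qed

lemma lift_in:
  assumes "p \<in> Aut (binary_structure M R)"
  shows "map_option p \<in> Aut T"
proof -
  have "map_option p \<in> point_stabilizer (Aut T) None"
    unfolding stabilizer_T using assms by (rule imageI)
  then show ?thesis by (simp add: point_stabilizer_def)
qed

lemma stabilizer_cases:
  assumes "g \<in> Aut T" "g None = None"
  obtains p where "g = map_option p" "p \<in> Aut (binary_structure M R)"
proof -
  have "g \<in> point_stabilizer (Aut T) None"
    using assms by (simp add: point_stabilizer_def)
  then show thesis unfolding stabilizer_T using that by (rule imageE)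
qed

lemma inv_in: "g \<in> Aut T \<Longrightarrow> inv g \<in> Aut T"
  by (rule Aut_inv[OF structure_T])

lemma permutes_\<Omega>: "g \<in> Aut T \<Longrightarrow> g permutes \<Omega>"
  using universe_T by (auto simp: Aut_def)

lemma inv_apply: "g \<in> Aut T \<Longrightarrow> inv g (g x) = x" "g \<in> Aut T \<Longrightarrow> g (inv g x) = x"
  using permutes_inverses[OF permutes_\<Omega>] by blast+

lemma apply_in: "g \<in> Aut T \<Longrightarrow> g x \<in> \<Omega> \<longleftrightarrow> x \<in> \<Omega>"
  by (rule permutes_in_image[OF permutes_\<Omega>])

lemma apply_eq: "g \<in> Aut T \<Longrightarrow> g x = g y \<longleftrightarrow> x = y"
  by (rule inj_eq[OF permutes_inj[OF permutes_\<Omega>]])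

lemma move_None:
  assumes "x \<in> \<Omega>"
  obtains g where "g \<in> Aut T" "g None = x"
proof -
  have "None \<in> \<Omega>" by simp
  then have "\<exists>g\<in>Aut T. g None = x"
    using transitive_T[unfolded transitive_on_def, THEN bspec, THEN bspec, OF _ assms]
    by simp
  then show thesis using that by (rule bexE)
qed

lemma point_cases:
  assumes "g \<in> Aut T" "z \<in> \<Omega>" "z \<noteq> g None"
  obtains d where "d \<in> M" "z = g (Some d)"
proof -
  have "inv g z \<in> \<Omega>" using assms(2) by (simp only: apply_in[OF inv_in[OF assms(1)]])
  moreover have "inv g z \<noteq> None" using assms(3) inv_apply(2)[OF assms(1), of z] by metis
  ultimately obtain d where "d \<in> M" "inv g z = Some d" by blast
  then show thesis using that inv_apply(2)[OF assms(1), of z] by simp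
qed

section \<open>Equivalence relations attached to the points\<close>

definition D :: "'a option \<Rightarrow> 'a option \<Rightarrow> 'a option \<Rightarrow> bool" where
  "D x y z \<longleftrightarrow> (\<exists>g \<in> Aut T. \<exists>u v. (u, v) \<in> R \<and> x = g None \<and> y = g (Some u) \<and> z = g (Some v))"

text \<open>The existential over \<open>g\<close> in \<open>D\<close> adds no pairs at
  \<open>None\<close>: such a \<open>g\<close> fixes \<open>None\<close>, hence acts on
  \<open>M\<close> as an automorphism of \<open>R\<close>.\<close>

lemma D_None: "D None (Some u) (Some v) \<longleftrightarrow> (u, v) \<in> R"
proof
  assume "D None (Some u) (Some v)"
  then obtain g u' v' where g: "g \<in> Aut T" "(u', v') \<in> R" "g None = None"
    "Some u = g (Some u')" "Some v = g (Some v')"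
    unfolding D_def by metis
  from g(1,3) obtain p where "g = map_option p" "p \<in> Aut (binary_structure M R)"
    by (rule stabilizer_cases)
  then show "(u, v) \<in> R" using g(2,4,5) R_in[OF g(2)] by (auto simp: Aut_binary_structure)
next
  assume "(u, v) \<in> R"
  moreover have "id \<in> Aut (binary_structure M R)" by (simp add: Aut_binary_structure permutes_id)
  from lift_in[OF this] have "id \<in> Aut T" by (simp add: option.map_id0)
  ultimately show "D None (Some u) (Some v)" unfolding D_def
    by (metis id_apply)
qed

lemma D_apply_imp:
  assumes h: "h \<in> Aut T" and D: "D x y z"
  shows "D (h x) (h y) (h z)"
proof -
  obtain g u v where g: "g \<in> Aut T" "(u, v) \<in> R" "x = g None" "y = g (Some u)" "z = g (Some v)"
    using D unfolding D_def by blast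
  have "h \<circ> g \<in> Aut T" using h g(1) by (rule Aut_comp)
  moreover have "h x = (h \<circ> g) None" "h y = (h \<circ> g) (Some u)" "h z = (h \<circ> g) (Some v)"
    using g(3-5) by simp_all
  ultimately show ?thesis unfolding D_def using g(2) by metis
qed

lemma D_apply:
  assumes "g \<in> Aut T"
  shows "D (g x) (g y) (g z) \<longleftrightarrow> D x y z"
proof
  assume "D (g x) (g y) (g z)"
  from D_apply_imp[OF inv_in[OF assms] this] show "D x y z"
    by (simp only: inv_apply[OF assms])
qed (rule D_apply_imp[OF assms])

lemma D_in:
  assumes "D x y z"
  shows "x \<in> \<Omega>" "y \<in> \<Omega>" "z \<in> \<Omega>" "x \<noteq> y" "x \<noteq> z"
proof -
  obtain g u v where g: "g \<in> Aut T" "(u, v) \<in> R" "x = g None" "y = g (Some u)" "z = g (Some v)"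
    using assms unfolding D_def by blast
  have "u \<in> M" "v \<in> M" using R_in g(2) by blast+
  then show "x \<in> \<Omega>" "y \<in> \<Omega>" "z \<in> \<Omega>" "x \<noteq> y" "x \<noteq> z"
    using apply_in[OF g(1)] apply_eq[OF g(1)] g(3-5) by simp_all
qed

lemma D_sym:
  assumes "D x y z"
  shows "D x z y"
proof -
  obtain g u v where g: "g \<in> Aut T" "(u, v) \<in> R" "x = g None" "y = g (Some u)" "z = g (Some v)"
    using assms unfolding D_def by blast
  then show ?thesis unfolding D_def using R_sym[OF g(2)] by blast
qed

text \<open>The two hypotheses may have different witnesses in \<open>Aut T\<close>. Pulling the
  second back along the witness \<open>g\<close> of the first moves both to \<open>None\<close>,
  where \<open>D_None\<close> turns them into statements about \<open>R\<close>.\<close>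

lemma D_trans:
  assumes "D x y z" "D x z w"
  shows "D x y w"
proof -
  obtain g u v where g: "g \<in> Aut T" "(u, v) \<in> R" "x = g None" "y = g (Some u)" "z = g (Some v)"
    using assms(1) unfolding D_def by blast
  have *: "D None (Some v) (inv g w)"
    using assms(2) g D_apply[OF g(1), of None "Some v" "inv g w"] by (simp add: inv_apply)
  then obtain t where t: "inv g w = Some t"
    using D_in(5) by (metis not_None_eq)
  then have "(v, t) \<in> R" using * D_None by simp
  then have "(u, t) \<in> R" using g(2) R_trans by blast
  moreover have "w = g (Some t)" using t inv_apply(2)[OF g(1)] by metis
  ultimately show ?thesis unfolding D_def using g by blast
qed

section \<open>Orbits and 2-transitivity\<close>

text \<open>The last clause confines the movement to the classes of \<open>a\<close> and
  \<open>b\<close>, so points of a third class can be kept fixed.\<close>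

lemma transitive_M:
  assumes "a \<in> M" "b \<in> M"
  obtains p where "p \<in> Aut (binary_structure M R)" "p a = b"
    "\<And>x. (a, x) \<notin> R \<Longrightarrow> (b, x) \<notin> R \<Longrightarrow> p x = x"
proof (cases "(a, b) \<in> R")
  case True
  show thesis
  proof (rule that)
    show "transpose a b \<in> Aut (binary_structure M R)"
      using equivalence True by (rule transpose_in_Aut_binary_structure)
    show "transpose a b x = x" if "(a, x) \<notin> R" "(b, x) \<notin> R" for x
      using that R_refl assms by (metis transpose_apply_other)
  qed simp
next
  case False
  have "R `` {a} \<approx> R `` {b}" using equal_classes assms by (meson quotientI)
  then show thesis using swap_classes[OF equivalence assms False] that by blast
qed

text \<open>Some automorphism of \<open>R\<close> fixes \<open>a\<close> and takes \<open>b\<close>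
  to \<open>c\<close>: a transposition inside the class of \<open>a\<close>, or a permutation
  disturbing only other classes. Its lift fixes \<open>None\<close> and
  \<open>Some a\<close>.\<close>

lemma two_point_orbits:
  assumes "a \<in> M" "b \<in> M" "c \<in> M" "b \<noteq> a" "c \<noteq> a" "(a, b) \<in> R \<longleftrightarrow> (a, c) \<in> R"
  shows "D (Some a) None (Some b) \<longleftrightarrow> D (Some a) None (Some c)"
proof -
  obtain p where p: "p \<in> Aut (binary_structure M R)" "p b = c" "p a = a"
  proof (cases "(a, b) \<in> R")
    case True
    then have "(b, c) \<in> R" using assms(6) R_sym R_trans by blast
    then have "transpose b c \<in> Aut (binary_structure M R)"
      using equivalence by (intro transpose_in_Aut_binary_structure)
    then show thesis using that assms(4,5) by (metis transpose_apply_first transpose_apply_other)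
  next
    case False
    then have "(b, a) \<notin> R" "(c, a) \<notin> R" using assms(6) R_sym by blast+
    then show thesis using transitive_M[OF assms(2,3)] that by metis
  qed
  then show ?thesis using D_apply[OF lift_in[OF p(1)], of "Some a" None "Some b"] by simp
qed

text \<open>Transport from \<open>None\<close> to \<open>Some a\<close> by \<open>g\<close>: the
  class of \<open>None\<close> under \<open>D (Some a)\<close> is the image of the class of
  \<open>u\<close>, which has a second point and does not exhaust \<open>M\<close>.\<close>

lemma D_nontrivial:
  assumes "a \<in> M"
  obtains b c where "b \<in> M" "b \<noteq> a" "D (Some a) None (Some b)"
    "c \<in> M" "c \<noteq> a" "\<not> D (Some a) None (Some c)"
proof -
  obtain g where g: "g \<in> Aut T" "g None = Some a" using move_None assms by blast
  have "None \<in> \<Omega>" "None \<noteq> g None" using g(2) by simp_all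
  then obtain u where uM: "u \<in> M" and "None = g (Some u)"
    by (rule point_cases[OF g(1)])
  then have u: "g (Some u) = None" by simp
  \<comment> \<open>The values \<open>None\<close> and \<open>Some a\<close> are already taken by
    \<open>g\<close> at \<open>Some u\<close> and \<open>None\<close>.\<close>
  have *: "\<exists>w\<in>M. w \<noteq> a \<and> g (Some v) = Some w" if "v \<in> M" "v \<noteq> u" for v
  proof -
    have "g (Some v) \<in> \<Omega>" using apply_in[OF g(1), of "Some v"] that by simp
    moreover have "g (Some v) \<noteq> None" "g (Some v) \<noteq> Some a"
      using that apply_eq[OF g(1), of "Some v" "Some u"] apply_eq[OF g(1), of "Some v" None] u g(2)
      by simp_all
    ultimately show ?thesis by auto
  qed
  have **: "D (Some a) None (g (Some v)) \<longleftrightarrow> (u, v) \<in> R" for v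
    using D_apply[OF g(1), of None "Some u" "Some v"] D_None g u by simp
  obtain v where v: "(u, v) \<in> R" "v \<noteq> u" using uM by (rule other_in_class)
  obtain w where w: "w \<in> M" "(u, w) \<notin> R" using uM by (rule other_class)
  then have "w \<noteq> u" using uM R_refl by blast
  from *[OF w(1) this] *[OF R_in(2)[OF v(1)] v(2)] show thesis
    using that ** v w by metis
qed

lemma two_transitive:
  assumes "x \<in> \<Omega>" "y \<in> \<Omega>" "x \<noteq> y" "a \<in> M"
  obtains g where "g \<in> Aut T" "g None = x" "g (Some a) = y"
proof -
  obtain g where g: "g \<in> Aut T" "g None = x" using move_None assms(1) by blast
  obtain b where b: "b \<in> M" "y = g (Some b)"
    using point_cases[OF g(1) assms(2)] assms(3) g(2) by blast
  obtain p where p: "p \<in> Aut (binary_structure M R)" "p a = b"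
    using transitive_M[OF assms(4) b(1)] by blast
  show thesis
  proof (rule that)
    show "g \<circ> map_option p \<in> Aut T" using Aut_comp g(1) lift_in p(1) by blast
  qed (use g p b in simp_all)
qed

text \<open>For \<open>x = None\<close> and \<open>y = Some a\<close>, the points \<open>d\<close>
  with \<open>D y x (Some d)\<close> form exactly one of the two orbits, either the rest of the
  class of \<open>a\<close> or the other classes; \<open>e\<close> records which. 2-transitivity
  carries the answer to all triples.\<close>

lemma dichotomy:
  obtains e where "\<And>x y z. x \<in> \<Omega> \<Longrightarrow> y \<in> \<Omega> \<Longrightarrow> z \<in> \<Omega> \<Longrightarrow> x \<noteq> y \<Longrightarrow> x \<noteq> z \<Longrightarrow> y \<noteq> z
    \<Longrightarrow> D y x z \<longleftrightarrow> D x y z = e"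
proof -
  obtain a where a: "a \<in> M" using two_classes by (auto elim!: quotientE)
  obtain b c where bc: "b \<in> M" "b \<noteq> a" "D (Some a) None (Some b)"
    "c \<in> M" "c \<noteq> a" "\<not> D (Some a) None (Some c)"
    using a by (rule D_nontrivial)
  \<comment> \<open>The witnesses \<open>b\<close> and \<open>c\<close> give different truth values,
    so they lie in different orbits, and the orbit of \<open>b\<close> is the one where the relation
    holds.\<close>
  have *: "D (Some a) None (Some d) \<longleftrightarrow> (a, d) \<in> R \<longleftrightarrow> (a, b) \<in> R" if "d \<in> M" "d \<noteq> a" for d
    using two_point_orbits[OF a that(1) bc(1) that(2) bc(2)]
      two_point_orbits[OF a that(1) bc(4) that(2) bc(5)] bc
      two_point_orbits[OF a bc(1) bc(4) bc(2) bc(5)] by blast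
  show thesis
  proof (rule that[of "(a, b) \<in> R"])
    fix x y z assume xyz: "x \<in> \<Omega>" "y \<in> \<Omega>" "z \<in> \<Omega>" "x \<noteq> y" "x \<noteq> z" "y \<noteq> z"
    obtain g where g: "g \<in> Aut T" "g None = x" "g (Some a) = y"
      using two_transitive[OF xyz(1,2,4) a] by blast
    obtain d where d: "d \<in> M" "z = g (Some d)"
      using point_cases[OF g(1) xyz(3)] xyz(5) g(2) by blast
    have "d \<noteq> a" using d(2) g(3) xyz(6) by blast
    have "D y x z \<longleftrightarrow> D (Some a) None (Some d)" "D x y z \<longleftrightarrow> (a, d) \<in> R"
      using D_apply[OF g(1), of "Some a" None "Some d"]
        D_apply[OF g(1), of None "Some a" "Some d"] D_None g d by simp_all
    then show "D y x z \<longleftrightarrow> D x y z = ((a, b) \<in> R)"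
      using *[OF d(1) \<open>d \<noteq> a\<close>] by blast
  qed
qed

text \<open>This excludes the case that \<open>e\<close> is false: three exchanges, one per side of
  the triangle, would turn \<open>D x y z\<close> into the negation of \<open>D x z y\<close>,
  against symmetry.\<close>

lemma D_exchange:
  assumes "D x y z" "y \<noteq> z"
  shows "D y x z"
proof -
  obtain e where e: "\<And>x y z. x \<in> \<Omega> \<Longrightarrow> y \<in> \<Omega> \<Longrightarrow> z \<in> \<Omega> \<Longrightarrow> x \<noteq> y \<Longrightarrow> x \<noteq> z \<Longrightarrow> y \<noteq> z
    \<Longrightarrow> D y x z \<longleftrightarrow> D x y z = e"
    using dichotomy by blast
  have in\<Omega>: "x \<in> \<Omega>" "y \<in> \<Omega>" "z \<in> \<Omega>" "x \<noteq> y" "x \<noteq> z" using D_in[OF assms(1)] by auto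
  have "D y x z \<longleftrightarrow> D x y z = e" "D z y x \<longleftrightarrow> D y z x = e" "D x z y \<longleftrightarrow> D z x y = e"
    using e in\<Omega> assms(2) by metis+
  moreover have "D x z y" using assms(1) by (rule D_sym)
  moreover have "D z x y \<longleftrightarrow> D z y x" "D y x z \<longleftrightarrow> D y z x"
    using D_sym[of z x y] D_sym[of z y x] D_sym[of y x z] D_sym[of y z x] by blast+
  ultimately show ?thesis using assms(1) by blast
qed

section \<open>A transposition that breaks a line\<close>

lemma contradiction: False
proof -
  obtain a where a: "a \<in> M" using two_classes by (auto elim!: quotientE)
  obtain b where b: "b \<in> M" "(a, b) \<notin> R" using a by (rule other_class)
  have neq: "a \<noteq> b" using a b R_refl by blast
  \<comment> \<open>Lines through \<open>None\<close> correspond to classes of \<open>R\<close>, and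
    \<open>a\<close>, \<open>b\<close> lie in different classes.\<close>
  have no_line: "\<not> D (Some b) (Some a) None"
  proof
    assume "D (Some b) (Some a) None"
    from D_exchange[OF D_sym[OF this]] have "D None (Some b) (Some a)" by simp
    then show False using b R_sym by (simp add: D_None)
  qed
  \<comment> \<open>The lines joining \<open>b\<close> to \<open>a\<close> and to
    \<open>None\<close> are distinct, so they meet only in \<open>b\<close>.\<close>
  have not_both: "\<not> D (Some b) None z" if "D (Some b) (Some a) z" for z
    using no_line D_trans[OF that] D_sym by blast
  obtain c where c: "c \<in> M" "c \<noteq> b" "D (Some a) (Some b) (Some c)"
  proof -
    have "Some a \<in> \<Omega>" "Some b \<in> \<Omega>" "Some a \<noteq> Some b" using a b neq by simp_all
    then obtain g where g: "g \<in> Aut T" "g None = Some a" "g (Some b) = Some b"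
      using b(1) by (rule two_transitive)
    \<comment> \<open>A third point \<open>c'\<close> on the line through \<open>None\<close> and
      \<open>b\<close>; \<open>g\<close> carries it to the third point \<open>c\<close> wanted on
      the line through \<open>a\<close> and \<open>b\<close>.\<close>
    obtain c' where c': "(b, c') \<in> R" "c' \<noteq> b" using b(1) by (rule other_in_class)
    have D: "D (Some a) (Some b) (g (Some c'))"
      using D_apply[OF g(1), of None "Some b" "Some c'"] D_None c' g by simp
    have neq_b: "g (Some c') \<noteq> Some b"
      using g(3) c'(2) apply_eq[OF g(1), of "Some c'" "Some b"] by simp
    then have "D (Some b) (Some a) (g (Some c'))"
      by (intro D_exchange[OF D]) simp
    then have "g (Some c') \<noteq> None" using no_line by metis
    then obtain c where "c \<in> M" "g (Some c') = Some c" using D_in(3)[OF D] by auto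
    then show thesis using that D neq_b by simp
  qed
  have D_ba: "D (Some b) (Some a) (Some c)"
    using c(3) by (rule D_exchange) (use c(2) in simp)
  have D_b: "D (Some b) None (Some d)" if "(b, d) \<in> R" "d \<noteq> b" for d
    by (rule D_exchange) (use that D_None in simp_all)
  \<comment> \<open>Otherwise \<open>c\<close> would be a second common point of the two lines
    through \<open>b\<close>.\<close>
  have bc: "(b, c) \<notin> R"
    using D_b[of c] not_both[OF D_ba] c(2) by blast
  obtain d where d: "(b, d) \<in> R" "d \<noteq> b" using b(1) by (rule other_in_class)
  have neq_d: "d \<noteq> a" "d \<noteq> c" using d(1) b(2) bc R_sym by blast+
  \<comment> \<open>Its lift fixes \<open>Some a\<close> and \<open>Some c\<close> but moves
    \<open>Some b\<close> to \<open>Some d\<close>. Thus \<open>d\<close> lies on the line through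
    \<open>a\<close> and \<open>c\<close>, which is the line through \<open>a\<close> and
    \<open>b\<close>, as well as on the line through \<open>None\<close> and
    \<open>b\<close>.\<close>
  have "transpose b d \<in> Aut (binary_structure M R)"
    using equivalence d(1) by (rule transpose_in_Aut_binary_structure)
  from D_apply_imp[OF lift_in[OF this] c(3)]
  have "D (Some a) (Some d) (Some c)"
    using neq_d neq c(2) by (simp add: transpose_apply_other)
  from D_trans[OF c(3) D_sym[OF this]]
  have "D (Some b) (Some a) (Some d)"
    by (rule D_exchange) (use d(2) in simp)
  then show False using not_both D_b[OF d] by blast
qed

end

theorem proposition5p1:
  fixes M :: "'a set" and R :: "('a \<times> 'a) set"
  assumes "equiv M R"
    and "\<exists>C \<in> M // R. \<exists>D \<in> M // R. C \<noteq> D"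
    and "\<forall>C \<in> M // R. \<forall>D \<in> M // R. C \<approx> D"
    and "\<forall>C \<in> M // R. \<exists>x \<in> C. \<exists>y \<in> C. x \<noteq> y"
  shows "\<not> (\<exists>T :: ('a option, 'f, 'r) fo_structure.
           transitive_extension (binary_structure M R) T)"
proof
  assume "\<exists>T :: ('a option, 'f, 'r) fo_structure. transitive_extension (binary_structure M R) T"
  then obtain T :: "('a option, 'f, 'r) fo_structure"
    where "transitive_extension (binary_structure M R) T" by blast
  then interpret equiv_transitive_extension M R T
    using assms by unfold_locales
  show False by (rule contradiction)
qed

end
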